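(* Take a finite-dimensional quantum system in the state $\rho(t)$ evolving via a time-independent Hamiltonian with $d_E$ energy levels (distinct energies). For any operator $A$ (nonzero), any $\varepsilon>0$ and any time $T>0$, $$\frac{\left\langle\left|\mathrm{tr}[\rho(t)A]-\mathrm{tr}[\omega A]\right|^2\right\rangle_T}{\|A\|^2}\le\frac{N(\varepsilon)}{d_{\rm eff}}\,\frac{5\pi}{2}\left[\frac34+\frac{1}{\varepsilon T}\right].$$
   Context: The Hamiltonian is $H=\sum_{n=1}^{d_E}E_nP_n$ with distinct energies $E_n$ and $P_n$ the projector onto the eigenspace of energy $E_n$; $\rho(t)=e^{-iHt}\rho(0)e^{iHt}$, where $\rho(0)$ is an arbitrary (pure or mixed) density operator. $\langle f(t)\rangle_T=\frac1T\int_0^Tf(t)\,dt$, $\langle f(t)\rangle_\infty=\lim_{T\to\infty}\langle f(t)\rangle_T$, and $\omega=\langle\rho(t)\rangle_\infty$ is the infinite-time average state. $\|A\|$ is the operator norm. The effective dimension is $d_{\rm eff}=1/\sum_n(\mathrm{tr}[P_n\rho(0)])^2$. For each pair $\alpha=(i,j)$ with $i\ne j$, the energy gap is $G_\alpha=E_i-E_j$, and $N(\varepsilon)=\max_E|\{\alpha:G_\alpha\in[E,E+\varepsilon)\}|$ is the maximum number of energy gaps (counted over pairs $\alpha$) in an interval of size $\varepsilon$. *)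

theory Defs
  imports "HOL-Analysis.Analysis"
begin

text \<open>Operators on the Hilbert space of a finite-dimensional system are matrices
  \<open>complex^'n^'n\<close>, acting on \<open>complex^'n\<close> by \<open>*v\<close>; the norm on \<open>complex^'n\<close> is the Hilbert space norm.\<close>

definition cinner :: "complex^'n \<Rightarrow> complex^'n \<Rightarrow> complex" where
  "cinner x y = (\<Sum>i\<in>UNIV. cnj (x $ i) * y $ i)"

definition cadjoint :: "complex^'n^'n \<Rightarrow> complex^'n^'n" where
  "cadjoint A = (\<chi> i j. cnj (A $ j $ i))"

definition hermitian :: "complex^'n^'n \<Rightarrow> bool" where
  "hermitian A \<longleftrightarrow> cadjoint A = A"

definition density_operator :: "complex^'n^'n \<Rightarrow> bool" where
  "density_operator \<rho> \<longleftrightarrow>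
     hermitian \<rho> \<and> (\<forall>x. 0 \<le> Re (cinner x (\<rho> *v x))) \<and> trace \<rho> = 1"

definition op_norm :: "complex^'n^'n \<Rightarrow> real" where
  "op_norm A = onorm (\<lambda>x. A *v x)"

text \<open>The class operations \<open>*\<close> and \<open>^\<close> on \<open>'a^'n^'n\<close> are componentwise, so matrix powers and
  the matrix exponential have to be introduced separately.\<close>

primrec mpow :: "complex^'n^'n \<Rightarrow> nat \<Rightarrow> complex^'n^'n" where
  "mpow A 0 = mat 1"
| "mpow A (Suc k) = A ** mpow A k"

definition mexp :: "complex^'n^'n \<Rightarrow> complex^'n^'n" where
  "mexp A = (\<Sum>k. (1 / fact k) *\<^sub>R mpow A k)"

text \<open>\<open>mat c ** H\<close> is the scalar multiple of \<open>H\<close> by the complex number \<open>c\<close>.\<close>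

definition evolve :: "complex^'n^'n \<Rightarrow> complex^'n^'n \<Rightarrow> real \<Rightarrow> complex^'n^'n" where
  "evolve H \<rho>0 t =
     mexp (mat (- \<i> * of_real t) ** H) ** \<rho>0 ** mexp (mat (\<i> * of_real t) ** H)"

definition time_average :: "(real \<Rightarrow> 'a::real_normed_vector) \<Rightarrow> real \<Rightarrow> 'a" where
  "time_average f T = (1 / T) *\<^sub>R integral {0..T} f"

definition infinite_time_average :: "(real \<Rightarrow> 'a::real_normed_vector) \<Rightarrow> 'a" where
  "infinite_time_average f = Lim at_top (time_average f)"

definition eigenspace :: "complex^'n^'n \<Rightarrow> real \<Rightarrow> (complex^'n) set" where
  "eigenspace H e = {x. H *v x = of_real e *s x}"

text \<open>The eigenvalues of a Hermitian matrix are real, so it is enough to consider real numbers.\<close>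

definition energies :: "complex^'n^'n \<Rightarrow> real set" where
  "energies H = {e. \<exists>x\<in>eigenspace H e. x \<noteq> 0}"

definition orthogonal_projector_onto :: "complex^'n^'n \<Rightarrow> (complex^'n) set \<Rightarrow> bool" where
  "orthogonal_projector_onto P S \<longleftrightarrow>
     hermitian P \<and> P ** P = P \<and> range (\<lambda>x. P *v x) = S"

definition hamiltonian_spectrum ::
  "complex^'n^'n \<Rightarrow> nat \<Rightarrow> (nat \<Rightarrow> real) \<Rightarrow> (nat \<Rightarrow> complex^'n^'n) \<Rightarrow> bool" where
  "hamiltonian_spectrum H dE E P \<longleftrightarrow>
     hermitian H \<and>
     bij_betw E {1..dE} (energies H) \<and>
     (\<forall>n\<in>{1..dE}. orthogonal_projector_onto (P n) (eigenspace H (E n))) \<and>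
     H = (\<Sum>n=1..dE. E n *\<^sub>R P n)"

text \<open>The traces below are real because \<open>P n\<close> and \<open>\<rho>0\<close> are Hermitian; \<open>Re\<close> is only a type conversion.\<close>

definition effective_dimension ::
  "nat \<Rightarrow> (nat \<Rightarrow> complex^'n^'n) \<Rightarrow> complex^'n^'n \<Rightarrow> real" where
  "effective_dimension dE P \<rho>0 = 1 / (\<Sum>n=1..dE. (Re (trace (P n ** \<rho>0)))\<^sup>2)"

text \<open>Gaps are counted by index pairs, so equal gaps of different pairs count separately. The
  maximum is over a finite set of values, each being at most \<open>dE\<^sup>2\<close>.\<close>

definition max_gap_count :: "nat \<Rightarrow> (nat \<Rightarrow> real) \<Rightarrow> real \<Rightarrow> nat" where
  "max_gap_count dE E \<epsilon> =
     Max (range (\<lambda>x::real. card {(i, j). i \<in> {1..dE} \<and> j \<in> {1..dE} \<and> i \<noteq> j \<and>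
                                       E i - E j \<in> {x..<x + \<epsilon>}}))"

end

theory Submission
  imports Defs "HOL-Probability.Characteristic_Functions"
begin

text \<open>
  In the energy basis the signal \<open>tr[\<rho>(t) A] - tr[\<omega> A]\<close> is the exponential sum over the gaps
  \<open>\<alpha> = (i, j)\<close>, \<open>i \<noteq> j\<close>, with frequencies \<open>G\<^sub>\<alpha>\<close> and coefficients \<open>v\<^sub>\<alpha> = tr[P\<^sub>i \<rho>(0) P\<^sub>j A]\<close>.
  The uniform average over \<open>[0, T]\<close> is dominated by a multiple of an average against a normal density
  of width proportional to \<open>T\<close>. The characteristic function of the latter is again Gaussian, so
  by Schur's test the average is at most
  \<open>\<Sum>\<^sub>\<alpha> |v\<^sub>\<alpha>|\<^sup>2\<close> times a Gaussian sum over the gaps. Sorting the gaps into intervals of length \<open>\<epsilon>\<close>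
  bounds that sum by \<open>N(\<epsilon>)\<close> times a Riemann sum of the Gaussian integral.
  Finally \<open>\<Sum>\<^sub>\<alpha> |v\<^sub>\<alpha>|\<^sup>2 \<le> \<parallel>A\<parallel>\<^sup>2 / d\<^sub>e\<^sub>f\<^sub>f\<close> follows from Bessel's inequality for the positive form
  \<open>(X, Y) \<mapsto> tr[\<rho>(0) X\<^sup>* Y]\<close>, for which the projectors \<open>P\<^sub>j\<close> are orthogonal; this form takes the place
  of a purification of \<open>\<rho>(0)\<close>.
\<close>

subsection \<open>Positive semidefinite matrices\<close>

lemma mat_mult_component: "(mat c ** M) $ i $ j = (c::'a::semiring_1) * M $ i $ j"
  by (simp add: matrix_matrix_mult_def mat_def if_distrib[where f="\<lambda>x. x * _"] sum.delta' cong: if_cong)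

lemma mult_mat_commute: "M ** (mat (c::'a::comm_semiring_1) ** N) = mat c ** (M ** N)"
  by (simp add: vec_eq_iff mat_mult_component matrix_matrix_mult_def[of M] sum_distrib_left mult.left_commute)

lemma trace_mat_mult: "trace (mat (c::'a::comm_semiring_1) ** M) = c * trace M"
  by (simp add: trace_def mat_mult_component sum_distrib_left)

lemma mult_sum_right: "A ** (\<Sum>i\<in>I. B i) = (\<Sum>i\<in>I. A ** (B i :: 'a::semiring_1^'n^'m))"
  by (simp add: vec_eq_iff matrix_matrix_mult_def sum_distrib_left sum.swap[of _ UNIV I])

lemma mult_sum_left: "(\<Sum>i\<in>I. B i) ** A = (\<Sum>i\<in>I. (B i :: 'a::semiring_1^'n^'m) ** A)"
  by (simp add: vec_eq_iff matrix_matrix_mult_def sum_distrib_right sum.swap[of _ UNIV I])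

lemma mult_diff_right: "A ** (B - C) = A ** B - A ** (C :: 'a::ring_1^'n^'m)"
  by (simp add: vec_eq_iff matrix_matrix_mult_def right_diff_distrib sum_subtractf)

lemma mult_diff_left: "(A - B) ** C = A ** C - B ** (C :: 'a::ring_1^'n^'m)"
  by (simp add: vec_eq_iff matrix_matrix_mult_def left_diff_distrib sum_subtractf)

lemma trace_sum: "trace (\<Sum>i\<in>I. A i) = (\<Sum>i\<in>I. trace (A i :: 'a::comm_semiring_1^'n^'n))"
  by (simp add: trace_def sum.swap[of _ UNIV I])

lemma mat_mat_mult: "mat a ** (mat b ** M) = mat (a * b) ** (M::'a::comm_semiring_1^'n^'m)"
  by (simp add: vec_eq_iff mat_mult_component mult.assoc)

lemma scaleR_eq_mat_mult: "r *\<^sub>R M = mat (complex_of_real r) ** (M::complex^'n^'m)"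
  by (simp add: vec_eq_iff mat_mult_component) (simp add: scaleR_conv_of_real)

lemma cadjoint_cadjoint [simp]: "cadjoint (cadjoint A) = A"
  by (simp add: cadjoint_def vec_eq_iff)

lemma cadjoint_mult: "cadjoint (A ** B) = cadjoint B ** cadjoint A"
  by (simp add: cadjoint_def vec_eq_iff matrix_matrix_mult_def mult.commute)

lemma cadjoint_diff: "cadjoint (A - B) = cadjoint A - cadjoint B"
  by (simp add: cadjoint_def vec_eq_iff)

lemma cadjoint_mat [simp]: "cadjoint (mat c) = mat (cnj c)"
  by (simp add: cadjoint_def vec_eq_iff mat_def)

lemma trace_cadjoint: "trace (cadjoint A) = cnj (trace A)"
  by (simp add: trace_def cadjoint_def)

lemma cinner_cadjoint: "cinner x (A *v y) = cinner (cadjoint A *v x) y"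
proof -
  have "cinner x (A *v y) = (\<Sum>i\<in>UNIV. \<Sum>j\<in>UNIV. cnj (x $ i) * A $ i $ j * y $ j)"
    by (simp add: cinner_def matrix_vector_mult_def sum_distrib_left mult.assoc)
  also have "\<dots> = (\<Sum>j\<in>UNIV. \<Sum>i\<in>UNIV. cnj (x $ i) * A $ i $ j * y $ j)"
    by (rule sum.swap)
  also have "\<dots> = cinner (cadjoint A *v x) y"
    by (simp add: cinner_def matrix_vector_mult_def cadjoint_def sum_distrib_left mult_ac)
  finally show ?thesis .
qed

lemma cinner_add_left: "cinner (x + y) z = cinner x z + cinner y z"
  by (simp add: cinner_def distrib_right sum.distrib)

lemma cinner_add_right: "cinner x (y + z) = cinner x y + cinner x z"
  by (simp add: cinner_def distrib_left sum.distrib)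

lemma cinner_diff_right: "cinner x (y - z) = cinner x y - cinner x z"
  by (simp add: cinner_def right_diff_distrib sum_subtractf)

lemma cinner_scale_left: "cinner (c *s x) y = cnj c * cinner x y"
  by (simp add: cinner_def sum_distrib_left mult.assoc)

lemma cinner_scale_right: "cinner x (c *s y) = c * cinner x y"
  by (simp add: cinner_def sum_distrib_left mult.left_commute)

lemma cnj_cinner: "cnj (cinner x y) = cinner y x"
  by (simp add: cinner_def mult.commute)

lemma cinner_self: "cinner x x = of_real ((norm x)\<^sup>2)"
proof -
  have "(norm x)\<^sup>2 = (\<Sum>i\<in>UNIV. (cmod (x $ i))\<^sup>2)"
    by (simp add: norm_vec_def L2_set_def sum_nonneg)
  then show ?thesis
    by (simp add: cinner_def complex_norm_square mult.commute flip: of_real_power)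
qed

text \<open>Testing \<open>z = - t * cnj b\<close> leaves a real quadratic in t, minimised at
  \<open>t = 1 / d\<close>. Both Cauchy-Schwarz inequalities below reduce to this bound, which also
  covers the degenerate case \<open>d = 0\<close>.\<close>

lemma discriminant_bound:
  fixes b :: complex and a d :: real
  assumes nn: "\<And>z. 0 \<le> a + 2 * Re (z * b) + (cmod z)\<^sup>2 * d" and d: "0 \<le> d"
  shows "(cmod b)\<^sup>2 \<le> a * d"
proof -
  have *: "0 \<le> a - 2 * t * (cmod b)\<^sup>2 + t\<^sup>2 * (cmod b)\<^sup>2 * d" for t
  proof -
    have "Re (of_real (- t) * cnj b * b) = - t * (cmod b)\<^sup>2"
      by (simp add: complex_mult_cnj cmod_power2 mult.assoc mult.commute[of "cnj b"] flip: of_real_power)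
    then show ?thesis
      using nn[of "of_real (- t) * cnj b"] by (simp add: norm_mult power_mult_distrib)
  qed
  show ?thesis
  proof (cases "d = 0")
    case True
    have "b = 0"
    proof (rule ccontr)
      assume "b \<noteq> 0"
      \<comment> \<open>For \<open>d = 0\<close> the expression is affine in t, and this t gives it
        the value -1.\<close>
      then show False
        using *[of "(a + 1) / (2 * (cmod b)\<^sup>2)"] True by simp
    qed
    then show ?thesis by (simp add: True)
  next
    case False
    with *[of "1 / d"] d show ?thesis
      by (simp add: field_simps power2_eq_square)
  qed
qed

text \<open>Positivity is separated from the unit trace because the argument passes to compressions
  \<open>P i ** \<rho> ** P i\<close> and remainders \<open>M - N\<close>, whose trace need not be
  1.\<close>

definition psd :: "complex^'n^'n \<Rightarrow> bool" where
  "psd M \<longleftrightarrow> hermitian M \<and> (\<forall>x. 0 \<le> Re (cinner x (M *v x)))"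

lemma hermitian_cinner_swap:
  assumes "hermitian M"
  shows "cinner x (M *v y) = cnj (cinner y (M *v x))"
  using assms by (metis cinner_cadjoint cnj_cinner hermitian_def)

lemma hermitian_cinner_real:
  assumes "hermitian M"
  shows "cinner x (M *v x) = of_real (Re (cinner x (M *v x)))"
  using hermitian_cinner_swap[OF assms, of x x] by (simp add: complex_eq_iff)

text \<open>The quadratic form is nonnegative at every \<open>x + z *s y\<close>; expanding in z
  gives the hypothesis of \<open>discriminant_bound\<close>.\<close>

lemma psd_cauchy_schwarz:
  assumes "psd M"
  shows "(cmod (cinner x (M *v y)))\<^sup>2 \<le> Re (cinner x (M *v x)) * Re (cinner y (M *v y))"
proof (rule discriminant_bound)
  have M: "hermitian M" using assms by (simp add: psd_def)
  fix z
  have "0 \<le> Re (cinner (x + z *s y) (M *v (x + z *s y)))"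
    using assms by (simp add: psd_def)
  also have "cinner (x + z *s y) (M *v (x + z *s y)) =
      cinner x (M *v x) + (z * cinner x (M *v y) + cnj (z * cinner x (M *v y)))
      + (z * cnj z) * cinner y (M *v y)"
    by (simp add: matrix_vector_right_distrib vector_scalar_commute cinner_add_left
        cinner_add_right cinner_scale_left cinner_scale_right algebra_simps
        hermitian_cinner_swap[OF M, of y x])
  also have "z * cnj z = of_real ((cmod z)\<^sup>2)" by (rule complex_norm_square[symmetric])
  finally show "0 \<le> Re (cinner x (M *v x)) + 2 * Re (z * cinner x (M *v y))
      + (cmod z)\<^sup>2 * Re (cinner y (M *v y))" by simp
qed (use assms in \<open>simp add: psd_def\<close>)

lemma cinner_axis_left: "cinner (axis i 1) x = x $ i"
proof -
  have "cinner (axis i 1) x = (\<Sum>k\<in>UNIV. if k = i then x $ k else 0)"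
    unfolding cinner_def by (rule sum.cong) (auto simp: axis_def)
  then show ?thesis by simp
qed

lemma matrix_vector_mult_axis_component: "(M *v axis j 1) $ i = M $ i $ (j::'n::finite)"
  for M :: "complex^'n^'m"
  by (simp add: matrix_vector_mult_def axis_def if_distrib[where f="(*) _"] cong: if_cong)

text \<open>Cauchy-Schwarz on basis vectors bounds each entry by two diagonal ones. This is the base
  case of the trace induction below.\<close>

lemma psd_eq_0_if_diag_0:
  assumes "psd M" "\<And>i. M $ i $ i = 0"
  shows "M = 0"
proof -
  have "M $ i $ j = 0" for i j
    using psd_cauchy_schwarz[OF assms(1), of "axis i 1" "axis j 1"] assms(2)
    by (simp add: cinner_axis_left matrix_vector_mult_axis_component)
  then show ?thesis by (simp add: vec_eq_iff)
qed

lemma psd_diag: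
  assumes "psd M"
  shows "M $ i $ i = of_real (Re (M $ i $ i))" "0 \<le> Re (M $ i $ i)"
proof -
  have "hermitian M" using assms by (simp add: psd_def)
  from hermitian_cinner_real[OF this, of "axis i 1"]
  show "M $ i $ i = of_real (Re (M $ i $ i))"
    by (simp add: cinner_axis_left matrix_vector_mult_axis_component)
  have "0 \<le> Re (cinner (axis i 1) (M *v axis i 1))"
    using assms unfolding psd_def by blast
  then show "0 \<le> Re (M $ i $ i)"
    by (simp add: cinner_axis_left matrix_vector_mult_axis_component)
qed

text \<open>Induction on the number of nonzero diagonal entries: subtracting the rank-one Schur
  complement at a nonzero diagonal entry keeps the matrix positive and clears that entry.\<close>

lemma trace_mult_psd_nonneg:
  fixes M S :: "complex^'n^'n"
  assumes "psd M" "psd S"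
  shows "0 \<le> Re (trace (M ** S))"
  using assms(1)
proof (induction "card {i. M $ i $ i \<noteq> 0}" arbitrary: M rule: less_induct)
  case less
  note M = less.prems
  have hM: "hermitian M" using M by (simp add: psd_def)
  show ?case
  proof (cases "\<exists>k. M $ k $ k \<noteq> 0")
    case False
    then have "M = 0" using psd_eq_0_if_diag_0[OF M] by blast
    then show ?thesis by (simp add: trace_def matrix_matrix_mult_def)
  next
    case True
    then obtain k where k: "M $ k $ k \<noteq> 0" by blast
    define d where "d = Re (M $ k $ k)"
    have Mkk: "M $ k $ k = of_real d" and d: "d > 0"
      using psd_diag[OF M, of k] k unfolding d_def
      by (simp_all, metis less_eq_real_def of_real_0)
    define v where "v = M *v axis k 1"
    have v: "v $ i = M $ i $ k" for i
      by (simp add: v_def matrix_vector_mult_axis_component)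
    \<comment> \<open>The rank-one matrix built from column k, scaled to agree with M at the entry
      (k, k).\<close>
    define N :: "complex^'n^'n" where "N = (\<chi> i j. v $ i * cnj (v $ j) / of_real d)"
    have Nv: "N *v x = (cinner v x / of_real d) *s v" for x
      by (simp add: N_def matrix_vector_mult_def cinner_def vec_eq_iff sum_distrib_left
          sum_distrib_right sum_divide_distrib mult_ac)
    have cNx: "cinner x (N *v x) = of_real ((cmod (cinner x v))\<^sup>2 / d)" for x
      unfolding Nv cinner_scale_right of_real_divide complex_norm_square
      by (simp add: cnj_cinner mult.commute)
    have "hermitian N"
      by (simp add: hermitian_def cadjoint_def N_def vec_eq_iff mult.commute)
    then have hMN: "hermitian (M - N)"
      using hM by (simp add: hermitian_def cadjoint_diff)
    have psdMN: "psd (M - N)"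
      unfolding psd_def
    proof (intro conjI allI hMN)
      fix x
      \<comment> \<open>Positivity of the remainder is Cauchy-Schwarz between x and the k-th basis
        vector.\<close>
      have "(cmod (cinner x v))\<^sup>2 \<le> Re (cinner x (M *v x)) * d"
        using psd_cauchy_schwarz[OF M, of x "axis k 1"]
        by (simp add: v_def d_def cinner_axis_left matrix_vector_mult_axis_component)
      then show "0 \<le> Re (cinner x ((M - N) *v x))"
        using d by (simp add: matrix_vector_mult_diff_rdistrib cinner_diff_right cNx field_simps)
    qed
    have Nkk: "(M - N) $ k $ k = 0"
      using d by (simp add: N_def v Mkk)
    \<comment> \<open>A zero diagonal entry of a positive matrix annihilates its row, so subtracting
      N revives no diagonal entry and the count strictly drops.\<close>
    have zero: "(M - N) $ i $ i = 0" if "M $ i $ i = 0" for i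
    proof -
      have "M $ i $ k = 0"
        using psd_cauchy_schwarz[OF M, of "axis i 1" "axis k 1"] that
        by (simp add: cinner_axis_left matrix_vector_mult_axis_component)
      then show ?thesis using that by (simp add: N_def v)
    qed
    have "{i. (M - N) $ i $ i \<noteq> 0} \<subset> {i. M $ i $ i \<noteq> 0}"
      using zero Nkk k by blast
    then have "card {i. (M - N) $ i $ i \<noteq> 0} < card {i. M $ i $ i \<noteq> 0}"
      by (intro psubset_card_mono) auto
    then have 1: "0 \<le> Re (trace ((M - N) ** S))"
      using less.hyps psdMN by blast
    have "trace (N ** S) = (\<Sum>i\<in>UNIV. \<Sum>j\<in>UNIV. v $ i * cnj (v $ j) / of_real d * S $ j $ i)"
      by (simp add: trace_def matrix_matrix_mult_def N_def)
    also have "\<dots> = (\<Sum>j\<in>UNIV. \<Sum>i\<in>UNIV. v $ i * cnj (v $ j) / of_real d * S $ j $ i)"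
      by (rule sum.swap)
    also have "\<dots> = cinner v (S *v v) / of_real d"
      by (simp add: cinner_def matrix_vector_mult_def sum_distrib_left sum_divide_distrib mult_ac)
    finally have "Re (trace (N ** S)) = Re (cinner v (S *v v)) / d"
      by simp
    then have 2: "0 \<le> Re (trace (N ** S))"
      using assms(2) d by (simp add: psd_def)
    show ?thesis using 1 2 by (simp add: mult_diff_left trace_sub)
  qed
qed

lemma psd_conjugate:
  assumes "psd M"
  shows "psd (X ** M ** cadjoint X)"
  unfolding psd_def
proof (intro conjI allI)
  show "hermitian (X ** M ** cadjoint X)"
    using assms by (simp add: psd_def hermitian_def cadjoint_mult matrix_mul_assoc)
  fix x
  have "cinner x ((X ** M ** cadjoint X) *v x) = cinner (cadjoint X *v x) (M *v (cadjoint X *v x))"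
    by (simp add: matrix_vector_mul_assoc[symmetric] cinner_cadjoint[of x X])
  then show "0 \<le> Re (cinner x ((X ** M ** cadjoint X) *v x))"
    using assms by (simp add: psd_def)
qed

section \<open>Operator norm and Gram matrices\<close>

lemma op_norm_bound: "norm (A *v x) \<le> op_norm A * norm x"
  unfolding op_norm_def by (rule onorm) (simp add: matrix_vector_mul_bounded_linear)

lemma op_norm_nonneg: "0 \<le> op_norm A"
  unfolding op_norm_def by (rule onorm_pos_le) (simp add: matrix_vector_mul_bounded_linear)

lemma norm_cinner_le: "cmod (cinner x y) \<le> norm x * norm y"
proof -
  have "psd (mat 1 :: complex^'n^'n)"
    by (simp add: psd_def hermitian_def cinner_self)
  from psd_cauchy_schwarz[OF this, of x y]
  have "(cmod (cinner x y))\<^sup>2 \<le> (norm x * norm y)\<^sup>2"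
    by (simp add: cinner_self power_mult_distrib)
  then show ?thesis by (rule power2_le_imp_le) simp
qed

text \<open>With \<open>y = cadjoint A *v x\<close>, the square of \<open>norm y\<close> equals
  \<open>cinner x (A *v y)\<close> and is at most \<open>norm x * (op_norm A * norm y)\<close>; one
  factor \<open>norm y\<close> cancels.\<close>

lemma op_norm_cadjoint_le: "op_norm (cadjoint A) \<le> op_norm A"
  unfolding op_norm_def[of "cadjoint A"]
proof (rule onorm_le)
  fix x
  let ?y = "cadjoint A *v x"
  have "(norm ?y)\<^sup>2 = cmod (cinner ?y ?y)" by (simp add: cinner_self norm_power)
  also have "\<dots> = cmod (cinner x (A *v ?y))" by (simp add: cinner_cadjoint)
  also have "\<dots> \<le> norm x * norm (A *v ?y)" by (rule norm_cinner_le)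
  also have "\<dots> \<le> norm x * (op_norm A * norm ?y)" by (intro mult_left_mono op_norm_bound) simp
  finally have "norm ?y * norm ?y \<le> (op_norm A * norm x) * norm ?y"
    by (simp add: power2_eq_square mult_ac)
  then show "norm ?y \<le> op_norm A * norm x"
    by (cases "norm ?y = 0") (use op_norm_nonneg[of A] in \<open>auto dest: mult_right_le_imp_le\<close>)
qed

lemma psd_gram: "psd (cadjoint X ** X)"
  by (simp add: psd_def hermitian_def cadjoint_mult matrix_vector_mul_assoc[symmetric]
      cinner_cadjoint[of _ "cadjoint X"] cinner_self)

text \<open>The identity scaled by the squared operator norm, minus \<open>cadjoint A ** A\<close>,
  is positive; \<open>trace_mult_psd_nonneg\<close> pairs it with M.\<close>

lemma trace_mult_gram_le:
  fixes A :: "complex^'n^'n"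
  assumes "psd M"
  shows "Re (trace (M ** (cadjoint A ** A))) \<le> (op_norm A)\<^sup>2 * Re (trace M)"
proof -
  let ?c = "complex_of_real ((op_norm A)\<^sup>2)"
  have "psd (mat ?c - cadjoint A ** A)"
    unfolding psd_def
  proof (intro conjI allI)
    show "hermitian (mat ?c - cadjoint A ** A)"
      by (simp add: hermitian_def cadjoint_diff cadjoint_mult)
    fix x :: "complex^'n"
    have "mat ?c *v x = ?c *s x"
      by (simp add: vec_eq_iff matrix_vector_mult_def mat_def if_distrib[where f="\<lambda>x. x * _"] cong: if_cong)
    moreover have "(norm (A *v x))\<^sup>2 \<le> (op_norm A)\<^sup>2 * (norm x)\<^sup>2"
      using power_mono[OF op_norm_bound[of A x], of 2] by (simp add: power_mult_distrib)
    ultimately show "0 \<le> Re (cinner x ((mat ?c - cadjoint A ** A) *v x))"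
      by (simp add: matrix_vector_mult_diff_rdistrib cinner_diff_right cinner_scale_right cinner_self
          matrix_vector_mul_assoc[symmetric] cinner_cadjoint[of _ "cadjoint A"]
          flip: of_real_power of_real_mult)
  qed
  from trace_mult_psd_nonneg[OF assms this] show ?thesis
    by (simp add: mult_diff_right trace_sub trace_mul_sym[of M "mat ?c"] trace_mat_mult
        flip: of_real_power)
qed

subsection \<open>Bessel's inequality for the form of a state\<close>

text \<open>For a purification psi of the state this is the inner product of X psi and Y psi. It is
  antilinear in X, linear in Y, and degenerate when the state is not invertible.\<close>

definition state_form :: "complex^'n^'n \<Rightarrow> complex^'n^'n \<Rightarrow> complex^'n^'n \<Rightarrow> complex" where
  "state_form \<rho> X Y = trace (\<rho> ** (cadjoint X ** Y))"

lemma state_form_add_right: "state_form \<rho> X (Y + Z) = state_form \<rho> X Y + state_form \<rho> X Z"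
  by (simp add: state_form_def matrix_add_ldistrib trace_add)

lemma state_form_scale_right: "state_form \<rho> X (mat c ** Y) = c * state_form \<rho> X Y"
  by (simp add: state_form_def mult_mat_commute trace_mat_mult)

lemma state_form_sum_right: "state_form \<rho> X (\<Sum>i\<in>I. Y i) = (\<Sum>i\<in>I. state_form \<rho> X (Y i))"
  by (simp add: state_form_def mult_sum_right trace_sum)

lemma state_form_swap:
  assumes "hermitian \<rho>"
  shows "state_form \<rho> X Y = cnj (state_form \<rho> Y X)"
proof -
  have "cnj (state_form \<rho> Y X) = trace (cadjoint (\<rho> ** (cadjoint Y ** X)))"
    by (simp add: trace_cadjoint state_form_def)
  also have "\<dots> = trace ((cadjoint X ** Y) ** \<rho>)"
    using assms by (simp add: cadjoint_mult hermitian_def)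
  also have "\<dots> = trace (\<rho> ** (cadjoint X ** Y))" by (rule trace_mul_sym)
  finally show ?thesis by (simp add: state_form_def)
qed

lemma state_form_self_nonneg:
  assumes "psd \<rho>"
  shows "0 \<le> Re (state_form \<rho> X X)"
  unfolding state_form_def by (rule trace_mult_psd_nonneg[OF assms psd_gram])

lemma state_form_self_real:
  assumes "psd \<rho>"
  shows "state_form \<rho> X X = of_real (Re (state_form \<rho> X X))"
  using assms state_form_swap[of \<rho> X X] by (simp add: psd_def complex_eq_iff)

lemma state_form_cauchy_schwarz:
  assumes "psd \<rho>"
  shows "(cmod (state_form \<rho> X Y))\<^sup>2 \<le> Re (state_form \<rho> X X) * Re (state_form \<rho> Y Y)"
proof (rule discriminant_bound)
  have h: "hermitian \<rho>" using assms by (simp add: psd_def)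
  fix z
  let ?Z = "X + mat z ** Y"
  have left: "state_form \<rho> ?Z W = state_form \<rho> X W + cnj z * state_form \<rho> Y W" for W
    by (subst (1 2 3) state_form_swap[OF h])
      (simp add: state_form_add_right state_form_scale_right)
  have "state_form \<rho> ?Z ?Z = state_form \<rho> X X + z * state_form \<rho> X Y
      + cnj z * (state_form \<rho> Y X + z * state_form \<rho> Y Y)"
    unfolding left by (simp add: state_form_add_right state_form_scale_right)
  also have "\<dots> = state_form \<rho> X X + (z * state_form \<rho> X Y + cnj (z * state_form \<rho> X Y))
      + (z * cnj z) * state_form \<rho> Y Y"
    by (subst state_form_swap[OF h, of Y X]) (simp add: algebra_simps)
  also have "z * cnj z = of_real ((cmod z)\<^sup>2)" by (rule complex_norm_square[symmetric])
  finally show "0 \<le> Re (state_form \<rho> X X) + 2 * Re (z * state_form \<rho> X Y)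
      + (cmod z)\<^sup>2 * Re (state_form \<rho> Y Y)"
    using state_form_self_nonneg[OF assms, of ?Z] by simp
qed (rule state_form_self_nonneg[OF assms])

text \<open>Z below is the projection of Y onto the span of the \<open>X i\<close>. Its form with Y
  and its form with itself both equal the sum s, so Cauchy-Schwarz bounds the square of s by s times
  the form of Y with itself.\<close>

lemma state_form_bessel:
  assumes "psd \<rho>" "finite I"
    and orth: "\<And>i j. i \<in> I \<Longrightarrow> j \<in> I \<Longrightarrow> i \<noteq> j \<Longrightarrow> state_form \<rho> (X i) (X j) = 0"
  shows "(\<Sum>i\<in>I. (cmod (state_form \<rho> (X i) Y))\<^sup>2 / Re (state_form \<rho> (X i) (X i)))
      \<le> Re (state_form \<rho> Y Y)"
proof -
  have h: "hermitian \<rho>" using assms by (simp add: psd_def)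
  define p where "p i = Re (state_form \<rho> (X i) (X i))" for i
  define c where "c i = state_form \<rho> (X i) Y" for i
  have p: "state_form \<rho> (X i) (X i) = of_real (p i)" "0 \<le> p i" for i
    using state_form_self_real[OF assms(1)] state_form_self_nonneg[OF assms(1)] by (simp_all add: p_def)
  \<comment> \<open>Directions with \<open>p i = 0\<close> drop out, since division by zero yields
    0.\<close>
  define Z where "Z = (\<Sum>i\<in>I. mat (c i / of_real (p i)) ** X i)"
  define s where "s = (\<Sum>i\<in>I. (cmod (c i))\<^sup>2 / p i)"
  have s: "0 \<le> s" unfolding s_def by (intro sum_nonneg divide_nonneg_nonneg) (auto simp: p)
  have cc: "cnj (c i) * c i = of_real ((cmod (c i))\<^sup>2)" for i
    by (subst mult.commute) (rule complex_norm_square[symmetric])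
  have Zl: "state_form \<rho> Z W = (\<Sum>i\<in>I. cnj (c i) / of_real (p i) * state_form \<rho> (X i) W)" for W
    by (subst state_form_swap[OF h])
      (simp add: Z_def state_form_sum_right state_form_scale_right state_form_swap[OF h, of _ W])
  have "state_form \<rho> Z Y = (\<Sum>i\<in>I. cnj (c i) * c i / of_real (p i))"
    unfolding Zl by (simp add: c_def)
  then have ZY: "state_form \<rho> Z Y = of_real s"
    unfolding cc by (simp add: s_def)
  \<comment> \<open>The quotient stays uncancelled because \<open>p i\<close> may be 0.\<close>
  have XZ: "state_form \<rho> (X i) Z = c i / of_real (p i) * of_real (p i)" if "i \<in> I" for i
  proof -
    have "state_form \<rho> (X i) Z = (\<Sum>j\<in>I. c j / of_real (p j) * state_form \<rho> (X i) (X j))"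
      by (simp add: Z_def state_form_sum_right state_form_scale_right)
    also have "\<dots> = (\<Sum>j\<in>I. if j = i then c i / of_real (p i) * of_real (p i) else 0)"
      by (rule sum.cong) (use that orth in \<open>auto simp: p\<close>)
    finally show ?thesis using that assms(2) by simp
  qed
  have "state_form \<rho> Z Z = (\<Sum>i\<in>I. cnj (c i) * c i / of_real (p i))"
    unfolding Zl by (rule sum.cong) (auto simp: XZ)
  then have ZZ: "state_form \<rho> Z Z = of_real s"
    unfolding cc by (simp add: s_def)
  have "s\<^sup>2 \<le> s * Re (state_form \<rho> Y Y)"
    using state_form_cauchy_schwarz[OF assms(1), of Z Y] by (simp add: ZY ZZ)
  then have "s \<le> Re (state_form \<rho> Y Y)"
    using s state_form_self_nonneg[OF assms(1), of Y]
    by (cases "s = 0") (auto simp: power2_eq_square)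
  then show ?thesis by (simp add: s_def c_def p_def)
qed

section \<open>Coherences between orthogonal projectors\<close>

locale projector_family =
  fixes P :: "'i \<Rightarrow> complex^'n^'n" and I :: "'i set"
  assumes finite_index: "finite I"
    and hermitian_projector: "i \<in> I \<Longrightarrow> cadjoint (P i) = P i"
    and idem: "i \<in> I \<Longrightarrow> P i ** P i = P i"
    and orthogonal: "i \<in> I \<Longrightarrow> j \<in> I \<Longrightarrow> i \<noteq> j \<Longrightarrow> P i ** P j = 0"
begin

lemma state_form_projectors:
  assumes "i \<in> I" "j \<in> I"
  shows "state_form \<rho> (P i) (P j) = (if i = j then trace (P i ** \<rho>) else 0)"
  using assms by (auto simp: state_form_def hermitian_projector idem orthogonal trace_mul_sym[of \<rho>]
      trace_def[of 0])

text \<open>For fixed i, cyclicity of the trace exhibits the coherences as the components of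
  \<open>A ** P i\<close> along the projectors \<open>P j\<close>, ready for Bessel's
  inequality.\<close>

lemma coherence_eq_state_form:
  assumes "i \<in> I" "j \<in> I"
  shows "trace (P i ** \<rho> ** P j ** A) = state_form \<rho> (P j) (A ** P i)"
proof -
  have "trace (P i ** \<rho> ** P j ** A) = trace (P i ** (\<rho> ** P j ** A))"
    by (simp add: matrix_mul_assoc)
  also have "\<dots> = trace (\<rho> ** P j ** A ** P i)" by (rule trace_mul_sym)
  finally show ?thesis using assms by (simp add: state_form_def hermitian_projector matrix_mul_assoc)
qed

text \<open>Cyclicity moves the state into the compression \<open>P i ** \<rho> ** P i\<close>,
  which is positive and has the population of level i as its trace.\<close>

lemma state_form_image_le:
  assumes "psd \<rho>" "i \<in> I"
  shows "Re (state_form \<rho> (A ** P i) (A ** P i)) \<le> (op_norm A)\<^sup>2 * Re (trace (P i ** \<rho>))"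
proof -
  let ?M = "P i ** \<rho> ** P i"
  have "psd ?M"
    using psd_conjugate[OF assms(1), of "P i"] assms(2) by (simp add: hermitian_projector)
  moreover have "state_form \<rho> (A ** P i) (A ** P i) = trace ((\<rho> ** P i ** (cadjoint A ** A)) ** P i)"
    using assms(2) by (simp add: state_form_def cadjoint_mult hermitian_projector matrix_mul_assoc)
  then have "state_form \<rho> (A ** P i) (A ** P i) = trace (?M ** (cadjoint A ** A))"
    by (subst (asm) trace_mul_sym) (simp add: matrix_mul_assoc)
  moreover have "trace ?M = trace (P i ** \<rho>)"
    using assms(2) by (subst trace_mul_sym) (simp add: matrix_mul_assoc idem)
  ultimately show ?thesis
    using trace_mult_gram_le[of ?M A] by simp
qed

lemma population_nonneg:
  assumes "psd \<rho>" "i \<in> I"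
  shows "0 \<le> Re (trace (P i ** \<rho>))"
  using state_form_self_nonneg[OF assms(1), of "P i"] assms(2) by (simp add: state_form_projectors)

text \<open>Bessel's inequality for \<open>A ** P i\<close> against all \<open>P j\<close>, whose
  squared lengths are the populations.\<close>

lemma coherence_row_le:
  assumes "psd \<rho>" "i \<in> I"
  shows "(\<Sum>j\<in>I. (cmod (trace (P i ** \<rho> ** P j ** A)))\<^sup>2 / Re (trace (P j ** \<rho>)))
      \<le> (op_norm A)\<^sup>2 * Re (trace (P i ** \<rho>))"
proof -
  have "(\<Sum>j\<in>I. (cmod (trace (P i ** \<rho> ** P j ** A)))\<^sup>2 / Re (trace (P j ** \<rho>)))
      = (\<Sum>j\<in>I. (cmod (state_form \<rho> (P j) (A ** P i)))\<^sup>2 / Re (state_form \<rho> (P j) (P j)))"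
    using assms(2) by (intro sum.cong) (simp_all add: coherence_eq_state_form state_form_projectors)
  also have "\<dots> \<le> Re (state_form \<rho> (A ** P i) (A ** P i))"
    by (rule state_form_bessel[OF assms(1) finite_index]) (simp add: state_form_projectors)
  finally show ?thesis using state_form_image_le[OF assms, of A] by simp
qed

text \<open>Complex conjugation exchanges i and j and replaces A by its adjoint, so columns reduce
  to rows.\<close>

lemma coherence_column_le:
  assumes "psd \<rho>" "j \<in> I"
  shows "(\<Sum>i\<in>I. (cmod (trace (P i ** \<rho> ** P j ** A)))\<^sup>2 / Re (trace (P i ** \<rho>)))
      \<le> (op_norm A)\<^sup>2 * Re (trace (P j ** \<rho>))"
proof -
  have h: "cadjoint \<rho> = \<rho>" using assms by (simp add: psd_def hermitian_def)
  have "cmod (trace (P i ** \<rho> ** P j ** A)) = cmod (trace (P j ** \<rho> ** P i ** cadjoint A))"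
    if "i \<in> I" for i
  proof -
    have "cnj (trace (P i ** \<rho> ** P j ** A)) = trace (cadjoint A ** (P j ** \<rho> ** P i))"
      using that assms(2)
      by (simp add: trace_cadjoint[symmetric] cadjoint_mult hermitian_projector h matrix_mul_assoc)
    also have "\<dots> = trace (P j ** \<rho> ** P i ** cadjoint A)" by (rule trace_mul_sym)
    finally show ?thesis by (metis complex_mod_cnj)
  qed
  then have "(\<Sum>i\<in>I. (cmod (trace (P i ** \<rho> ** P j ** A)))\<^sup>2 / Re (trace (P i ** \<rho>)))
      = (\<Sum>i\<in>I. (cmod (trace (P j ** \<rho> ** P i ** cadjoint A)))\<^sup>2 / Re (trace (P i ** \<rho>)))"
    by (intro sum.cong) simp_all
  also have "\<dots> \<le> (op_norm (cadjoint A))\<^sup>2 * Re (trace (P j ** \<rho>))"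
    by (rule coherence_row_le[OF assms])
  also have "\<dots> \<le> (op_norm A)\<^sup>2 * Re (trace (P j ** \<rho>))"
    by (intro mult_right_mono power_mono op_norm_cadjoint_le op_norm_nonneg population_nonneg assms)
  finally show ?thesis .
qed

text \<open>Cauchy-Schwarz for a single pair. It makes coherences with an unpopulated level vanish,
  which the weighted row and column sums cannot detect because division by zero yields 0.\<close>

lemma coherence_sq_le:
  assumes "psd \<rho>" "i \<in> I" "j \<in> I"
  shows "(cmod (trace (P i ** \<rho> ** P j ** A)))\<^sup>2
      \<le> (op_norm A)\<^sup>2 * Re (trace (P i ** \<rho>)) * Re (trace (P j ** \<rho>))"
proof -
  have "(cmod (trace (P i ** \<rho> ** P j ** A)))\<^sup>2
      \<le> Re (trace (P j ** \<rho>)) * Re (state_form \<rho> (A ** P i) (A ** P i))"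
    using state_form_cauchy_schwarz[OF assms(1), of "P j" "A ** P i"] assms
    by (simp add: coherence_eq_state_form state_form_projectors)
  also have "\<dots> \<le> Re (trace (P j ** \<rho>)) * ((op_norm A)\<^sup>2 * Re (trace (P i ** \<rho>)))"
    by (intro mult_left_mono state_form_image_le population_nonneg assms)
  finally show ?thesis by (simp add: mult_ac)
qed

text \<open>With \<open>w = |v\<^sub>i\<^sub>j|\<^sup>2 / (p\<^sub>i p\<^sub>j)\<close>, bound \<open>|v\<^sub>i\<^sub>j|\<^sup>2 = w p\<^sub>i p\<^sub>j\<close> by \<open>w (p\<^sub>i\<^sup>2 + p\<^sub>j\<^sup>2) / 2\<close>
  and apply Bessel's inequality to the rows and to the columns of \<open>w\<close>.\<close>

lemma sum_coherence_sq_le: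
  assumes "psd \<rho>"
  shows "(\<Sum>i\<in>I. \<Sum>j\<in>I. (cmod (trace (P i ** \<rho> ** P j ** A)))\<^sup>2)
      \<le> (op_norm A)\<^sup>2 * (\<Sum>i\<in>I. (Re (trace (P i ** \<rho>)))\<^sup>2)"
proof -
  define p where "p i = Re (trace (P i ** \<rho>))" for i
  define V where "V i j = (cmod (trace (P i ** \<rho> ** P j ** A)))\<^sup>2" for i j
  have p: "0 \<le> p i" if "i \<in> I" for i
    using population_nonneg[OF assms that] by (simp add: p_def)
  have V: "V i j \<le> (p i * (V i j / p j) + p j * (V i j / p i)) / 2" if "i \<in> I" "j \<in> I" for i j
  proof (cases "p i = 0 \<or> p j = 0")
    case True
    have "V i j \<le> (op_norm A)\<^sup>2 * p i * p j"
      using coherence_sq_le[OF assms that] by (simp add: V_def p_def)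
    then have "V i j \<le> 0" using True by auto
    moreover have "0 \<le> V i j" by (simp add: V_def)
    ultimately show ?thesis by simp
  next
    case False
    then have pp: "p i > 0" "p j > 0" using p that by (force simp: less_le)+
    \<comment> \<open>The arithmetic-geometric mean inequality, with its defect written as a
      weighted square.\<close>
    have "p i * (V i j / p j) + p j * (V i j / p i) - 2 * V i j
        = V i j * (p i - p j)\<^sup>2 / (p i * p j)"
      using pp by (simp add: field_simps power2_eq_square)
    moreover have "0 \<le> V i j * (p i - p j)\<^sup>2 / (p i * p j)"
      using pp by (simp add: V_def)
    ultimately show ?thesis by simp
  qed
  let ?c = "(op_norm A)\<^sup>2"
  have row: "(\<Sum>i\<in>I. \<Sum>j\<in>I. p i * (V i j / p j)) \<le> (\<Sum>i\<in>I. p i * (?c * p i))"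
    unfolding sum_distrib_left[symmetric]
    by (intro sum_mono mult_left_mono p)
      (use coherence_row_le[OF assms] in \<open>simp_all add: V_def p_def\<close>)
  have "(\<Sum>i\<in>I. \<Sum>j\<in>I. p j * (V i j / p i)) = (\<Sum>j\<in>I. \<Sum>i\<in>I. p j * (V i j / p i))"
    by (rule sum.swap)
  also have "\<dots> \<le> (\<Sum>j\<in>I. p j * (?c * p j))"
    unfolding sum_distrib_left[symmetric]
    by (intro sum_mono mult_left_mono p)
      (use coherence_column_le[OF assms] in \<open>simp_all add: V_def p_def\<close>)
  finally have col: "(\<Sum>i\<in>I. \<Sum>j\<in>I. p j * (V i j / p i)) \<le> (\<Sum>j\<in>I. p j * (?c * p j))" .
  have "(\<Sum>i\<in>I. \<Sum>j\<in>I. V i j) \<le> (\<Sum>i\<in>I. \<Sum>j\<in>I. (p i * (V i j / p j) + p j * (V i j / p i)) / 2)"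
    by (intro sum_mono V)
  also have "\<dots> = ((\<Sum>i\<in>I. \<Sum>j\<in>I. p i * (V i j / p j)) + (\<Sum>i\<in>I. \<Sum>j\<in>I. p j * (V i j / p i))) / 2"
    by (simp add: sum.distrib add_divide_distrib sum_divide_distrib)
  also have "\<dots> \<le> (\<Sum>i\<in>I. p i * (?c * p i))"
    using row col by simp
  also have "\<dots> = ?c * (\<Sum>i\<in>I. (p i)\<^sup>2)"
    by (simp add: sum_distrib_left power2_eq_square mult_ac)
  finally show ?thesis by (simp add: V_def p_def)
qed

end

subsection \<open>Gaussian averages of exponential sums\<close>

text \<open>The integrand decreases on the nonnegative axis, so the sum over right endpoints,
  starting at m = 1, stays below the half-line integral.\<close>

lemma gaussian_riemann_sum_le:
  fixes h :: real
  assumes "h > 0"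
  shows "(\<Sum>m=1..M. h * exp (- (real m * h)\<^sup>2)) \<le> sqrt pi / 2"
proof -
  let ?f = "\<lambda>x::real. exp (- x\<^sup>2)"
  have int: "?f integrable_on {a..b}" for a b
    by (intro integrable_continuous_interval continuous_intros)
  have "(\<Sum>m=1..M. h * ?f (real m * h)) \<le> integral {0..real M * h} ?f"
  proof (induction M)
    case (Suc M)
    let ?a = "real M * h" and ?b = "real (Suc M) * h"
    have ab: "0 \<le> ?a" "?a \<le> ?b" "?b - ?a = h" using assms by (auto simp: algebra_simps)
    have "h * ?f ?b = integral {?a..?b} (\<lambda>_. ?f ?b)"
      using ab by simp
    also have "\<dots> \<le> integral {?a..?b} ?f"
    proof (intro integral_le int integrable_const_ivl)
      fix x assume "x \<in> {?a..?b}"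
      then have "0 \<le> x" "x \<le> ?b" using ab(1) by auto
      then show "?f ?b \<le> ?f x" by (simp add: power_mono)
    qed
    finally have "(\<Sum>m=1..Suc M. h * ?f (real m * h)) \<le> integral {0..?a} ?f + integral {?a..?b} ?f"
      using Suc by simp
    also have "\<dots> = integral {0..?b} ?f"
      by (rule Henstock_Kurzweil_Integration.integral_combine) (use ab int in auto)
    finally show ?case .
  qed simp
  also have "\<dots> \<le> integral {0..} ?f"
  proof -
    have "set_integrable lborel {0..} ?f"
      using gaussian_moment_0 unfolding set_integrable_def by (rule integrable.intros)
    from set_borel_integral_eq_integral(1)[OF this] show ?thesis
      by (intro integral_subset_le int) auto
  qed
  also have "\<dots> = sqrt pi / 2"
  proof -
    have "set_integrable lborel {0..} ?f"
      using gaussian_moment_0 unfolding set_integrable_def by (rule integrable.intros)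
    from set_borel_integral_eq_integral(2)[OF this] show ?thesis
      using has_bochner_integral_integral_eq[OF gaussian_moment_0]
      by (simp add: set_lebesgue_integral_def)
  qed
  finally show ?thesis .
qed

text \<open>The term m = 0 contributes 1. The mesh \<open>h / sqrt 2\<close> turns the remaining
  terms into the preceding Riemann sum.\<close>

lemma gaussian_sum_le:
  fixes h :: real
  assumes "h > 0"
  shows "(\<Sum>m\<le>M. exp (- (real m * h)\<^sup>2 / 2)) \<le> 1 + sqrt (2 * pi) / (2 * h)"
proof -
  let ?k = "h / sqrt 2"
  have "?k * (\<Sum>m=1..M. exp (- (real m * h)\<^sup>2 / 2)) = (\<Sum>m=1..M. ?k * exp (- (real m * ?k)\<^sup>2))"
    by (simp add: sum_distrib_left power_divide power_mult_distrib)
  also have "\<dots> \<le> sqrt pi / 2"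
    using assms by (intro gaussian_riemann_sum_le) simp
  finally have "(\<Sum>m=1..M. exp (- (real m * h)\<^sup>2 / 2)) \<le> sqrt (2 * pi) / (2 * h)"
    using assms by (simp add: field_simps real_sqrt_mult)
  moreover have "(\<Sum>m\<le>M. exp (- (real m * h)\<^sup>2 / 2)) = 1 + (\<Sum>m=1..M. exp (- (real m * h)\<^sup>2 / 2))"
    by (simp add: atMost_atLeast0 sum.atLeast_Suc_atMost)
  ultimately show ?thesis by simp
qed

text \<open>Group the points by \<open>q = \<lfloor>(G\<^sub>\<beta> - y) / \<epsilon>\<rfloor>\<close>, merging \<open>q = m\<close> with \<open>q = -m - 1\<close>: each group
  lies in two half-open intervals of length \<open>\<epsilon>\<close>, at distance at least \<open>m \<epsilon>\<close> from \<open>y\<close>.\<close>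

lemma gaussian_gap_sum_le:
  fixes G :: "'i \<Rightarrow> real"
  assumes fin: "finite I" and "\<epsilon> > 0" "\<tau> > 0"
    and N: "\<And>x. card {\<beta>\<in>I. G \<beta> \<in> {x..<x + \<epsilon>}} \<le> N"
  shows "(\<Sum>\<beta>\<in>I. exp (- ((y - G \<beta>) * \<tau>)\<^sup>2 / 2)) \<le> real N * (2 + sqrt (2 * pi) / (\<epsilon> * \<tau>))"
proof -
  define q where "q \<beta> = \<lfloor>(G \<beta> - y) / \<epsilon>\<rfloor>" for \<beta>
  define m where "m \<beta> = nat (if q \<beta> \<ge> 0 then q \<beta> else - q \<beta> - 1)" for \<beta>
  define f where "f k = exp (- (real k * (\<epsilon> * \<tau>))\<^sup>2 / 2)" for k
  have q: "y + of_int (q \<beta>) * \<epsilon> \<le> G \<beta>" "G \<beta> < y + of_int (q \<beta>) * \<epsilon> + \<epsilon>" for \<beta>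
    using floor_divide_lower[OF assms(2), of "G \<beta> - y"] floor_divide_upper[OF assms(2), of "G \<beta> - y"]
    by (simp_all add: q_def algebra_simps)
  have dist: "real (m \<beta>) * \<epsilon> \<le> \<bar>y - G \<beta>\<bar>" for \<beta>
  proof (cases "q \<beta> \<ge> 0")
    case True
    then have "real (m \<beta>) * \<epsilon> = of_int (q \<beta>) * \<epsilon>" by (simp add: m_def)
    then show ?thesis using q(1)[of \<beta>] by linarith
  next
    case False
    then have "real (m \<beta>) * \<epsilon> = - (of_int (q \<beta>) * \<epsilon>) - \<epsilon>"
      by (simp add: m_def algebra_simps)
    then show ?thesis using q(2)[of \<beta>] by linarith
  qed
  have le: "exp (- ((y - G \<beta>) * \<tau>)\<^sup>2 / 2) \<le> f (m \<beta>)" for \<beta>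
  proof -
    have "real (m \<beta>) * \<epsilon> * \<tau> \<le> \<bar>y - G \<beta>\<bar> * \<tau>"
      using dist assms by (intro mult_right_mono) auto
    then have "(real (m \<beta>) * (\<epsilon> * \<tau>))\<^sup>2 \<le> (\<bar>y - G \<beta>\<bar> * \<tau>)\<^sup>2"
      using assms by (intro power_mono) (auto simp: mult.assoc)
    then show ?thesis by (simp add: f_def power_mult_distrib)
  qed
  have card: "card {\<beta>\<in>I. m \<beta> = k} \<le> 2 * N" for k
  proof -
    let ?S = "\<lambda>j::int. {\<beta>\<in>I. G \<beta> \<in> {y + of_int j * \<epsilon>..<y + of_int j * \<epsilon> + \<epsilon>}}"
    have "{\<beta>\<in>I. m \<beta> = k} \<subseteq> ?S (int k) \<union> ?S (- int k - 1)"
    proof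
      fix \<beta> assume \<beta>: "\<beta> \<in> {\<beta>\<in>I. m \<beta> = k}"
      then have "q \<beta> = int k \<or> q \<beta> = - int k - 1"
        by (auto simp: m_def split: if_splits)
      moreover have "\<beta> \<in> ?S (q \<beta>)" using q[of \<beta>] \<beta> by simp
      ultimately have "\<beta> \<in> ?S (int k) \<or> \<beta> \<in> ?S (- int k - 1)" by fastforce
      then show "\<beta> \<in> ?S (int k) \<union> ?S (- int k - 1)" by (simp only: Un_iff)
    qed
    then have "card {\<beta>\<in>I. m \<beta> = k} \<le> card (?S (int k) \<union> ?S (- int k - 1))"
      using fin by (intro card_mono) auto
    also have "\<dots> \<le> card (?S (int k)) + card (?S (- int k - 1))" by (rule card_Un_le)
    also have "\<dots> \<le> N + N" by (intro add_mono N)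
    finally show ?thesis by simp
  qed
  obtain M where M: "m ` I \<subseteq> {..M}"
    using finite_nat_set_iff_bounded_le[of "m ` I"] fin by auto
  have "(\<Sum>\<beta>\<in>I. exp (- ((y - G \<beta>) * \<tau>)\<^sup>2 / 2)) \<le> (\<Sum>\<beta>\<in>I. f (m \<beta>))"
    by (intro sum_mono le)
  also have "\<dots> = (\<Sum>k\<le>M. \<Sum>\<beta>\<in>{\<beta>\<in>I. m \<beta> = k}. f (m \<beta>))"
    using M fin by (intro sum.group[symmetric]) auto
  also have "\<dots> = (\<Sum>k\<le>M. real (card {\<beta>\<in>I. m \<beta> = k}) * f k)" by simp
  also have "\<dots> \<le> (\<Sum>k\<le>M. real (2 * N) * f k)"
    by (intro sum_mono mult_right_mono of_nat_mono card) (simp add: f_def)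
  also have "\<dots> = 2 * real N * (\<Sum>k\<le>M. f k)" by (simp add: sum_distrib_left)
  also have "\<dots> \<le> 2 * real N * (1 + sqrt (2 * pi) / (2 * (\<epsilon> * \<tau>)))"
    unfolding f_def using assms by (intro mult_left_mono gaussian_sum_le) auto
  also have "\<dots> = real N * (2 + sqrt (2 * pi) / (\<epsilon> * \<tau>))"
    by (simp add: algebra_simps)
  finally show ?thesis .
qed

text \<open>Schur's test: the arithmetic-geometric mean inequality splits \<open>v a * v b\<close>
  into two squares, and by symmetry of K the row sums control both halves.\<close>

lemma schur_sum_le:
  fixes v :: "'i \<Rightarrow> real" and K :: "'i \<Rightarrow> 'i \<Rightarrow> real"
  assumes K: "\<And>a b. K a b = K b a" "\<And>a b. 0 \<le> K a b"
    and R: "\<And>a. a \<in> I \<Longrightarrow> (\<Sum>b\<in>I. K a b) \<le> R"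
  shows "(\<Sum>a\<in>I. \<Sum>b\<in>I. v a * v b * K a b) \<le> R * (\<Sum>a\<in>I. (v a)\<^sup>2)"
proof -
  have amgm: "v a * v b * K a b \<le> (v a)\<^sup>2 / 2 * K a b + (v b)\<^sup>2 / 2 * K a b" for a b
    using mult_right_mono[OF sum_squares_bound[of "v a" "v b"] K(2)[of a b]]
    by (simp add: algebra_simps)
  have half: "(\<Sum>a\<in>I. \<Sum>b\<in>I. (v a)\<^sup>2 / 2 * K a b) \<le> (\<Sum>a\<in>I. (v a)\<^sup>2 / 2 * R)"
    unfolding sum_distrib_left[symmetric] by (intro sum_mono mult_left_mono R) auto
  have "(\<Sum>a\<in>I. \<Sum>b\<in>I. (v b)\<^sup>2 / 2 * K a b) = (\<Sum>b\<in>I. \<Sum>a\<in>I. (v b)\<^sup>2 / 2 * K b a)"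
    by (subst sum.swap) (simp add: K(1)[of _ _])
  with half have half': "(\<Sum>a\<in>I. \<Sum>b\<in>I. (v b)\<^sup>2 / 2 * K a b) \<le> (\<Sum>a\<in>I. (v a)\<^sup>2 / 2 * R)"
    by simp
  have "(\<Sum>a\<in>I. \<Sum>b\<in>I. v a * v b * K a b)
      \<le> (\<Sum>a\<in>I. \<Sum>b\<in>I. (v a)\<^sup>2 / 2 * K a b + (v b)\<^sup>2 / 2 * K a b)"
    by (intro sum_mono amgm)
  also have "\<dots> \<le> (\<Sum>a\<in>I. (v a)\<^sup>2 / 2 * R) + (\<Sum>a\<in>I. (v a)\<^sup>2 / 2 * R)"
    using half half' by (simp add: sum.distrib)
  also have "\<dots> = R * (\<Sum>a\<in>I. (v a)\<^sup>2)"
    by (simp add: sum.distrib[symmetric] sum_distrib_left mult_ac)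
  finally show ?thesis .
qed

section \<open>From uniform to Gaussian time averages\<close>

lemma norm_sum_square:
  fixes z :: "'i \<Rightarrow> complex"
  shows "of_real ((cmod (\<Sum>a\<in>I. z a))\<^sup>2) = (\<Sum>a\<in>I. \<Sum>b\<in>I. z a * cnj (z b))"
  unfolding complex_norm_square by (simp add: sum_product)

text \<open>The squared modulus expands into a double sum of phases, each integrating to the
  characteristic function of the standard normal law. The shift s enters only through the unimodular
  factor in \<open>w\<close>, which disappears in absolute value.\<close>

lemma gaussian_average_le:
  fixes G :: "'i \<Rightarrow> real" and v :: "'i \<Rightarrow> complex"
  assumes fin: "finite I"
  defines "g \<equiv> \<lambda>t. \<Sum>a\<in>I. v a * cis (- (G a * t))"
  shows "integrable std_normal_distribution (\<lambda>z. (cmod (g (s + \<tau> * z)))\<^sup>2)"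
    and "(\<integral>z. (cmod (g (s + \<tau> * z)))\<^sup>2 \<partial>std_normal_distribution)
      \<le> (\<Sum>a\<in>I. \<Sum>b\<in>I. cmod (v a) * cmod (v b) * exp (- ((G a - G b) * \<tau>)\<^sup>2 / 2))"
proof -
  interpret real_distribution std_normal_distribution by (rule real_dist_normal_dist)
  define w where "w a b = v a * cnj (v b) * cis (- ((G a - G b) * s))" for a b
  have eq: "of_real ((cmod (g (s + \<tau> * z)))\<^sup>2) =
      (\<Sum>a\<in>I. \<Sum>b\<in>I. w a b * iexp (- ((G a - G b) * \<tau>) * z))" for z
    unfolding g_def norm_sum_square w_def
    by (intro sum.cong refl) (simp add: cis_conv_exp exp_add[symmetric] exp_cnj mult_ac algebra_simps)
  have int: "integrable std_normal_distribution (\<lambda>z. w a b * iexp (- ((G a - G b) * \<tau>) * z))" for a b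
    by (intro integrable_mult_right integrable_iexp) auto
  have intc: "integrable std_normal_distribution (\<lambda>z. complex_of_real ((cmod (g (s + \<tau> * z)))\<^sup>2))"
    unfolding eq by (intro Bochner_Integration.integrable_sum int)
  have "integrable std_normal_distribution (\<lambda>z. Re (complex_of_real ((cmod (g (s + \<tau> * z)))\<^sup>2)))"
    using intc by (rule integrable_Re)
  then show int_real: "integrable std_normal_distribution (\<lambda>z. (cmod (g (s + \<tau> * z)))\<^sup>2)"
    unfolding Re_complex_of_real .
  have "complex_of_real (\<integral>z. (cmod (g (s + \<tau> * z)))\<^sup>2 \<partial>std_normal_distribution)
      = (\<integral>z. complex_of_real ((cmod (g (s + \<tau> * z)))\<^sup>2) \<partial>std_normal_distribution)"
    by (rule integral_of_real[OF int_real, symmetric])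
  also have "\<dots> = (\<Sum>a\<in>I. \<Sum>b\<in>I. w a b * char std_normal_distribution (- ((G a - G b) * \<tau>)))"
    unfolding eq char_def using int by (simp add: Bochner_Integration.integral_sum)
  finally have *: "complex_of_real (\<integral>z. (cmod (g (s + \<tau> * z)))\<^sup>2 \<partial>std_normal_distribution)
      = (\<Sum>a\<in>I. \<Sum>b\<in>I. w a b * char std_normal_distribution (- ((G a - G b) * \<tau>)))" .
  have "(\<integral>z. (cmod (g (s + \<tau> * z)))\<^sup>2 \<partial>std_normal_distribution)
      \<le> cmod (complex_of_real (\<integral>z. (cmod (g (s + \<tau> * z)))\<^sup>2 \<partial>std_normal_distribution))"
    by simp
  also have "\<dots> \<le> (\<Sum>a\<in>I. \<Sum>b\<in>I. cmod (w a b * char std_normal_distribution (- ((G a - G b) * \<tau>))))"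
    unfolding * by (rule order_trans[OF norm_sum]) (intro sum_mono norm_sum)
  also have "\<dots> = (\<Sum>a\<in>I. \<Sum>b\<in>I. cmod (v a) * cmod (v b) * exp (- ((G a - G b) * \<tau>)\<^sup>2 / 2))"
    by (simp add: w_def char_std_normal_distribution norm_mult)
  finally show "(\<integral>z. (cmod (g (s + \<tau> * z)))\<^sup>2 \<partial>std_normal_distribution)
      \<le> (\<Sum>a\<in>I. \<Sum>b\<in>I. cmod (v a) * cmod (v b) * exp (- ((G a - G b) * \<tau>)\<^sup>2 / 2))" .
qed

text \<open>On \<open>[0, T]\<close> the uniform density is at most \<open>5 / 4 * b * sqrt (2 * pi)\<close> times the normal density
  with mean \<open>T / 2\<close> and standard deviation \<open>b * T\<close>, \<open>b = 5 / 6\<close>, since \<open>exp (9 / 50) \<le> 5 / 4\<close>.\<close>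

lemma exp_9_50_le: "exp (9 / 50 :: real) \<le> 5 / 4"
proof -
  \<comment> \<open>Inverting \<open>1 + x <= exp x\<close> at x = -9/50 leaves 50/41, which is
    below 5/4.\<close>
  have "41 / 50 \<le> exp (- (9 / 50) :: real)" using exp_ge_add_one_self[of "- (9 / 50) :: real"] by simp
  then show ?thesis by (simp add: exp_minus field_simps)
qed

lemma time_average_le_gaussian_average:
  fixes F :: "real \<Rightarrow> real"
  assumes "T > 0" and nonneg: "\<And>t. 0 \<le> F t" and cont: "continuous_on UNIV F"
    and int: "integrable std_normal_distribution (\<lambda>z. F (T / 2 + 5 / 6 * T * z))"
  shows "time_average F T \<le>
    25 / 24 * sqrt (2 * pi) * (\<integral>z. F (T / 2 + 5 / 6 * T * z) \<partial>std_normal_distribution)"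
proof -
  let ?c = "5 / 6 * T" and ?k = "5 / 4 * sqrt (2 * pi)"
  let ?\<phi> = "\<lambda>z. F (T / 2 + ?c * z)"
  have [measurable]: "F \<in> borel_measurable borel"
    using cont by (rule borel_measurable_continuous_onI)
  have "set_integrable lborel {0..T} F"
    by (rule borel_integrable_atLeastAtMost') (rule continuous_on_subset[OF cont], simp)
  then have "integral {0..T} F = (\<integral>t. indicator {0..T} t *\<^sub>R F t \<partial>lborel)"
    using set_borel_integral_eq_integral(2) by (metis set_lebesgue_integral_def)
  \<comment> \<open>Substitution \<open>t = T / 2 + 5 / 6 * T * z\<close>.\<close>
  also have "\<dots> = ?c * (\<integral>z. indicator {0..T} (T / 2 + ?c * z) *\<^sub>R ?\<phi> z \<partial>lborel)"
    using assms(1) by (subst lborel_integral_real_affine[where c = ?c and t = "T / 2"]) auto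
  also have "\<dots> \<le> ?c * (\<integral>z. ?k * (std_normal_density z * ?\<phi> z) \<partial>lborel)"
  proof (intro mult_left_mono integral_mono')
    show "integrable lborel (\<lambda>z. ?k * (std_normal_density z * ?\<phi> z))"
      by (rule integrable_mult_right) (use int in \<open>subst (asm) integrable_density; auto\<close>)
    fix z :: real
    show "0 \<le> ?k * (std_normal_density z * ?\<phi> z)" using nonneg by simp
    show "indicator {0..T} (T / 2 + ?c * z) *\<^sub>R ?\<phi> z \<le> ?k * (std_normal_density z * ?\<phi> z)"
    proof (cases "T / 2 + ?c * z \<in> {0..T}")
      case True
      \<comment> \<open>The interval [0, T] corresponds to z of modulus at most (1/2) / (5/6) = 3/5,
        whence the exponent 9/50.\<close>
      then have "T * (- (3 / 5)) \<le> T * z" "T * z \<le> T * (3 / 5)"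
        by (simp_all add: field_simps)
      then have "- (3 / 5) \<le> z" "z \<le> 3 / 5"
        using assms(1) by (simp_all only: mult_le_cancel_left_pos)
      then have "\<bar>z\<bar> \<le> 3 / 5" by simp
      then have "\<bar>z\<bar>\<^sup>2 \<le> (3 / 5)\<^sup>2" by (intro power_mono) auto
      then have "exp (z\<^sup>2 / 2) \<le> exp (9 / 50)" by (simp add: power2_eq_square)
      then have "exp (z\<^sup>2 / 2) \<le> 5 / 4" using exp_9_50_le by linarith
      then have "1 \<le> 5 / 4 * exp (- z\<^sup>2 / 2)" by (simp add: exp_minus field_simps)
      also have "\<dots> = ?k * std_normal_density z"
        by (simp add: std_normal_density_def field_simps)
      finally have "1 * ?\<phi> z \<le> ?k * std_normal_density z * ?\<phi> z"
        by (intro mult_right_mono nonneg)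
      then show ?thesis using True by (simp add: mult.assoc)
    qed (use nonneg in simp)
  qed (use assms(1) in simp)
  also have "(\<integral>z. ?k * (std_normal_density z * ?\<phi> z) \<partial>lborel) = ?k * (\<integral>z. ?\<phi> z \<partial>std_normal_distribution)"
    by (subst integral_density) (auto)
  \<comment> \<open>The constant is 5/6 from the substitution times 5/4 from the density
    comparison.\<close>
  finally show ?thesis
    using assms(1) by (simp add: time_average_def field_simps)
qed

text \<open>Gaussian domination, the Gaussian integral and Schur's test combine here, the row sums
  being Gaussian sums over gaps. The width of the Gaussian cancels in the
  \<open>1 / (\<epsilon> * T)\<close> term, so the comparison constant 5/4 alone produces 5 pi / 2
  there.\<close>

lemma time_average_exponential_sum_le:
  fixes G :: "'i \<Rightarrow> real" and v :: "'i \<Rightarrow> complex"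
  assumes fin: "finite I" and "\<epsilon> > 0" "T > 0"
    and N: "\<And>x. card {\<beta>\<in>I. G \<beta> \<in> {x..<x + \<epsilon>}} \<le> N"
  shows "time_average (\<lambda>t. (cmod (\<Sum>a\<in>I. v a * cis (- (G a * t))))\<^sup>2) T
    \<le> real N * (\<Sum>a\<in>I. (cmod (v a))\<^sup>2) * (5 * pi / 2) * (3 / 4 + 1 / (\<epsilon> * T))"
proof -
  let ?\<tau> = "5 / 6 * T" and ?g = "\<lambda>t. (\<Sum>a\<in>I. v a * cis (- (G a * t)))"
  let ?S = "\<Sum>a\<in>I. (cmod (v a))\<^sup>2"
  have "time_average (\<lambda>t. (cmod (?g t))\<^sup>2) T \<le> 25 / 24 * sqrt (2 * pi) *
      (\<integral>z. (cmod (?g (T / 2 + ?\<tau> * z)))\<^sup>2 \<partial>std_normal_distribution)"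
    by (rule time_average_le_gaussian_average[OF assms(3) _ _ gaussian_average_le(1)[OF fin]])
      (auto intro!: continuous_intros)
  also have "\<dots> \<le> 25 / 24 * sqrt (2 * pi) *
      (\<Sum>a\<in>I. \<Sum>b\<in>I. cmod (v a) * cmod (v b) * exp (- ((G a - G b) * ?\<tau>)\<^sup>2 / 2))"
    by (intro mult_left_mono gaussian_average_le(2)[OF fin]) simp
  also have "\<dots> \<le> 25 / 24 * sqrt (2 * pi) * (real N * (2 + sqrt (2 * pi) / (\<epsilon> * ?\<tau>)) * ?S)"
  proof (intro mult_left_mono schur_sum_le)
    show "exp (- ((G a - G b) * ?\<tau>)\<^sup>2 / 2) = exp (- ((G b - G a) * ?\<tau>)\<^sup>2 / 2)" for a b
      by (metis mult_minus_left minus_diff_eq power2_minus)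
    show "(\<Sum>b\<in>I. exp (- ((G a - G b) * ?\<tau>)\<^sup>2 / 2)) \<le> real N * (2 + sqrt (2 * pi) / (\<epsilon> * ?\<tau>))" for a
      by (rule gaussian_gap_sum_le) (use assms in auto)
  qed auto
  also have "\<dots> = real N * ?S * (25 / 12 * sqrt (2 * pi) + 5 / 2 * pi / (\<epsilon> * T))"
  proof -
    have "sqrt (2 * pi) * (sqrt (2 * pi) / (\<epsilon> * ?\<tau>)) = 12 / 5 * pi / (\<epsilon> * T)"
      using assms by (simp add: field_simps)
    then have "25 / 24 * sqrt (2 * pi) * (2 + sqrt (2 * pi) / (\<epsilon> * ?\<tau>))
        = 25 / 12 * sqrt (2 * pi) + 5 / 2 * pi / (\<epsilon> * T)"
      by (simp add: distrib_left mult.assoc)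
    moreover have "x * (N * R * S) = N * S * (x * R)" for x N R S :: real
      by (simp only: mult_ac)
    ultimately show ?thesis by (simp only:)
  qed
  also have "\<dots> \<le> real N * ?S * (5 * pi / 2 * (3 / 4 + 1 / (\<epsilon> * T)))"
  proof (intro mult_left_mono)
    \<comment> \<open>The factor 9/10 is exactly what turns 25/12 into 15/8 = (5/2) * (3/4).\<close>
    have "sqrt (2 * pi) \<le> 9 / 10 * pi"
    proof (rule real_le_lsqrt)
      have "2 \<le> 81 / 100 * pi" using pi_gt3 by simp
      then have "2 * pi \<le> 81 / 100 * pi * pi" by (intro mult_right_mono) auto
      then show "2 * pi \<le> (9 / 10 * pi)\<^sup>2" by (simp add: power2_eq_square)
    qed auto
    then show "25 / 12 * sqrt (2 * pi) + 5 / 2 * pi / (\<epsilon> * T) \<le> 5 * pi / 2 * (3 / 4 + 1 / (\<epsilon> * T))"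
      by (simp add: algebra_simps)
  qed (simp add: sum_nonneg)
  finally show ?thesis by (simp only: mult.assoc)
qed

subsection \<open>Spectral form of the evolution\<close>

text \<open>Carries series, integrals and limits of scalar coefficients over to matrices.\<close>

lemma bounded_linear_mat_mult: "bounded_linear (\<lambda>c. mat c ** (M :: complex^'n^'m))"
proof -
  have "linear (\<lambda>c. mat c ** M)"
    by (rule linearI) (simp_all add: vec_eq_iff mat_mult_component distrib_right)
  then show ?thesis by (simp add: linear_conv_bounded_linear)
qed

text \<open>Orthogonality comes from evaluating \<open>P n ** H ** P m\<close> in two ways with
  distinct energies. Completeness comes from the expansion of H together with the fact that
  \<open>E\<close> exhausts the spectrum.\<close>

lemma hamiltonian_spectrum_projectors:
  assumes "hamiltonian_spectrum H dE E P"
  shows "n \<in> {1..dE} \<Longrightarrow> H ** P n = mat (of_real (E n)) ** P n"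
    and "projector_family P {1..dE}"
    and "(\<Sum>n=1..dE. P n) = mat 1"
proof -
  have hH: "cadjoint H = H" and bij: "bij_betw E {1..dE} (energies H)"
    and H: "H = (\<Sum>n=1..dE. E n *\<^sub>R P n)"
    using assms by (auto simp: hamiltonian_spectrum_def hermitian_def)
  have P: "cadjoint (P n) = P n" "P n ** P n = P n" "range (\<lambda>x. P n *v x) = eigenspace H (E n)"
    if "n \<in> {1..dE}" for n
    using assms that by (auto simp: hamiltonian_spectrum_def orthogonal_projector_onto_def hermitian_def)
  have HP: "H ** P n = mat (of_real (E n)) ** P n" if "n \<in> {1..dE}" for n
  proof -
    have "(H ** P n) *v x = (mat (of_real (E n)) ** P n) *v x" for x
    proof -
      have "P n *v x \<in> eigenspace H (E n)" using P(3)[OF that] by blast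
      then have "H *v (P n *v x) = of_real (E n) *s (P n *v x)" by (simp add: eigenspace_def)
      also have "\<dots> = (mat (of_real (E n)) ** P n) *v x"
        by (simp add: vec_eq_iff matrix_vector_mult_def mat_mult_component sum_distrib_left mult.assoc)
      finally show ?thesis by (simp add: matrix_vector_mul_assoc)
    qed
    then show ?thesis by (simp add: matrix_eq)
  qed
  then show "n \<in> {1..dE} \<Longrightarrow> H ** P n = mat (of_real (E n)) ** P n" .
  have PH: "P n ** H = mat (of_real (E n)) ** P n" if "n \<in> {1..dE}" for n
  proof -
    have "P n ** H = cadjoint (H ** P n)" by (simp add: cadjoint_mult hH P(1)[OF that])
    also have "\<dots> = P n ** mat (of_real (E n))"
      unfolding HP[OF that] by (simp add: cadjoint_mult P(1)[OF that])
    finally show ?thesis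
      using mult_mat_commute[of "P n" "of_real (E n)" "mat 1"] by simp
  qed
  have orth: "P n ** P m = 0" if "n \<in> {1..dE}" "m \<in> {1..dE}" "n \<noteq> m" for n m
  proof -
    have ne: "E n \<noteq> E m" using bij_betw_imp_inj_on[OF bij] that by (metis inj_onD)
    have "mat (of_real (E n)) ** (P n ** P m) = (P n ** H) ** P m"
      by (simp add: PH[OF that(1)] matrix_mul_assoc)
    also have "\<dots> = P n ** (H ** P m)" by (simp add: matrix_mul_assoc)
    also have "\<dots> = mat (of_real (E m)) ** (P n ** P m)"
      by (simp only: HP[OF that(2)] mult_mat_commute)
    finally show ?thesis using ne
      by (simp add: vec_eq_iff mat_mult_component)
  qed
  then show "projector_family P {1..dE}"
    by unfold_locales (use P in auto)
  have HnP: "E n *\<^sub>R P n = H ** P n" if "n \<in> {1..dE}" for n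
    using HP[OF that] by (simp add: scaleR_eq_mat_mult)
  \<comment> \<open>The defect of completeness. H annihilates its range, so a nonzero vector there
    would be an eigenvector of energy 0, hence in the range of some \<open>P m\<close>, although
    \<open>P m ** Q = 0\<close>.\<close>
  define Q where "Q = mat 1 - (\<Sum>n=1..dE. P n)"
  have "H ** (\<Sum>n=1..dE. P n) = H"
    unfolding mult_sum_right using H HnP by simp
  then have HQ: "H ** Q = 0" by (simp add: Q_def mult_diff_right)
  have PQ: "P m ** Q = 0" if "m \<in> {1..dE}" for m
  proof -
    have "P m ** (\<Sum>n=1..dE. P n) = (\<Sum>n=1..dE. if n = m then P m else 0)"
      unfolding mult_sum_right using that by (intro sum.cong) (auto simp: P(2) orth)
    then show ?thesis using that by (simp add: Q_def mult_diff_right)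
  qed
  have "Q *v x = 0" for x
  proof (rule ccontr)
    assume ne: "Q *v x \<noteq> 0"
    have eig: "Q *v x \<in> eigenspace H 0"
      by (simp add: eigenspace_def matrix_vector_mul_assoc HQ)
    then have "0 \<in> energies H" using ne by (auto simp: energies_def)
    then have "0 \<in> E ` {1..dE}" using bij by (simp add: bij_betw_def)
    then obtain m where m: "m \<in> {1..dE}" "E m = 0" by (metis imageE)
    then obtain y where "Q *v x = P m *v y" using eig P(3)[OF m(1)] by auto
    then have "Q *v x = P m *v (Q *v x)" by (simp add: matrix_vector_mul_assoc P(2)[OF m(1)])
    then show False using ne PQ[OF m(1)] by (simp add: matrix_vector_mul_assoc)
  qed
  then have "Q = 0" by (simp add: matrix_eq)
  then show "(\<Sum>n=1..dE. P n) = mat 1" by (simp add: Q_def)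
qed

text \<open>H acts as a scalar on each \<open>P n\<close>, so powers follow by induction with
  completeness as the case k = 0; the series is then summed in each coefficient.\<close>

lemma mexp_spectral:
  assumes "finite I"
    and HP: "\<And>n. n \<in> I \<Longrightarrow> H ** P n = mat (of_real (E n)) ** P n"
    and id: "(\<Sum>n\<in>I. P n) = mat 1"
  shows "mexp (mat z ** H) = (\<Sum>n\<in>I. mat (exp (z * of_real (E n))) ** P n)"
proof -
  have pow: "mpow (mat z ** H) k = (\<Sum>n\<in>I. mat ((z * of_real (E n)) ^ k) ** P n)" for k
  proof (induction k)
    case (Suc k)
    have "mpow (mat z ** H) (Suc k)
        = (\<Sum>n\<in>I. (mat z ** H) ** (mat ((z * of_real (E n)) ^ k) ** P n))"
      by (simp add: Suc.IH mult_sum_right)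
    also have "\<dots> = (\<Sum>n\<in>I. mat ((z * of_real (E n)) ^ Suc k) ** P n)"
    proof (rule sum.cong[OF refl])
      fix n assume "n \<in> I"
      have "(mat z ** H) ** (mat ((z * of_real (E n)) ^ k) ** P n)
          = mat ((z * of_real (E n)) ^ k) ** (mat z ** (H ** P n))"
        by (subst mult_mat_commute) (simp only: matrix_mul_assoc)
      then show "(mat z ** H) ** (mat ((z * of_real (E n)) ^ k) ** P n)
          = mat ((z * of_real (E n)) ^ Suc k) ** P n"
        by (simp add: HP[OF \<open>n \<in> I\<close>] mat_mat_mult mult_ac)
    qed
    finally show ?case .
  qed (simp add: id)
  have "(\<lambda>k. \<Sum>n\<in>I. mat ((z * of_real (E n)) ^ k /\<^sub>R fact k) ** P n) sums
      (\<Sum>n\<in>I. mat (exp (z * of_real (E n))) ** P n)"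
    by (intro sums_sum bounded_linear.sums[OF bounded_linear_mat_mult] exp_converges)
  also have "(\<lambda>k. \<Sum>n\<in>I. mat ((z * of_real (E n)) ^ k /\<^sub>R fact k) ** P n)
      = (\<lambda>k. (1 / fact k) *\<^sub>R mpow (mat z ** H) k)"
    unfolding pow scaleR_sum_right unfolding scaleR_eq_mat_mult mat_mat_mult
    by (simp add: scaleR_conv_of_real divide_inverse)
  finally show ?thesis unfolding mexp_def by (rule sums_unique[symmetric])
qed

lemma evolve_spectral:
  assumes "hamiltonian_spectrum H dE E P"
  shows "evolve H \<rho> t =
    (\<Sum>m=1..dE. \<Sum>n=1..dE. mat (cis (- ((E m - E n) * t))) ** (P m ** \<rho> ** P n))"
proof -
  have spec: "mexp (mat z ** H) = (\<Sum>n=1..dE. mat (exp (z * of_real (E n))) ** P n)" for z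
    by (intro mexp_spectral hamiltonian_spectrum_projectors[OF assms] finite_atLeastAtMost)
  have scal: "mat a ** X ** \<rho> ** (mat b ** Y) = mat (a * b) ** (X ** \<rho> ** Y)" for a b and X Y :: "complex^'a^'a"
  proof -
    have "mat a ** X ** \<rho> ** (mat b ** Y) = mat b ** (mat a ** (X ** \<rho> ** Y))"
      by (subst mult_mat_commute) (simp only: matrix_mul_assoc)
    then show ?thesis by (simp add: mat_mat_mult mult.commute)
  qed
  have phase: "exp (- \<i> * of_real t * of_real (E m)) * exp (\<i> * of_real t * of_real (E n))
      = cis (- ((E m - E n) * t))" for m n
    by (simp add: cis_conv_exp exp_add[symmetric] algebra_simps)
  have "evolve H \<rho> t = (\<Sum>m=1..dE. \<Sum>n=1..dE.
      mat (exp (- \<i> * of_real t * of_real (E m)) * exp (\<i> * of_real t * of_real (E n))) ** (P m ** \<rho> ** P n))"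
    unfolding evolve_def spec mult_sum_left unfolding mult_sum_right scal ..
  then show ?thesis unfolding phase .
qed

section \<open>Time averages of phases and sums of phases\<close>

lemma time_average_sum:
  fixes f :: "'i \<Rightarrow> real \<Rightarrow> 'a::banach"
  assumes "\<And>a. a \<in> I \<Longrightarrow> continuous_on UNIV (f a)" "finite I"
  shows "time_average (\<lambda>t. \<Sum>a\<in>I. f a t) T = (\<Sum>a\<in>I. time_average (f a) T)"
proof -
  have "f a integrable_on {0..T}" if "a \<in> I" for a
    by (intro integrable_continuous_real continuous_on_subset[OF assms(1)[OF that]]) simp
  then show ?thesis
    unfolding time_average_def using assms(2) by (simp add: integral_sum scaleR_sum_right)
qed

text \<open>A nonzero frequency has a bounded antiderivative, so its average decays like 1 / T; a
  zero frequency averages to 1 for every positive T.\<close>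

lemma infinite_time_average_cis:
  "(time_average (\<lambda>t. cis (- (g * t))) \<longlongrightarrow> (if g = 0 then 1 else 0)) at_top"
proof (cases "g = 0")
  case True
  have "\<forall>\<^sub>F T in at_top. time_average (\<lambda>t. cis (- (g * t))) T = 1"
    using eventually_gt_at_top[of 0]
    by eventually_elim (simp add: True time_average_def scaleR_conv_of_real)
  then show ?thesis using True by (simp add: tendsto_eventually)
next
  case False
  define F where "F t = \<i> / of_real g * cis (- (g * t))" for t
  have "((\<lambda>t. cis (- (g * t))) has_integral (F T - F 0)) {0..T}" if "T > 0" for T
  proof (rule fundamental_theorem_of_calculus)
    fix t
    show "(F has_vector_derivative cis (- (g * t))) (at t within {0..T})"
      unfolding F_def cis_conv_exp using False
      by (auto intro!: derivative_eq_intros has_vector_derivative_real_field simp: field_simps)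
  qed (use that in simp)
  then have avg: "time_average (\<lambda>t. cis (- (g * t))) T = (1 / T) *\<^sub>R (F T - F 0)" if "T > 0" for T
    using that by (simp add: time_average_def integral_unique)
  have "((\<lambda>T. (1 / T) *\<^sub>R (F T - F 0)) \<longlongrightarrow> 0) at_top"
  proof (rule Lim_null_comparison)
    show "\<forall>\<^sub>F T in at_top. norm ((1 / T) *\<^sub>R (F T - F 0)) \<le> (2 / \<bar>g\<bar>) / T"
      using eventually_gt_at_top[of 0]
    proof eventually_elim
      fix T :: real assume "T > 0"
      have "norm (F T - F 0) \<le> norm (F T) + norm (F 0)" by (rule norm_triangle_ineq4)
      also have "\<dots> = 2 / \<bar>g\<bar>" by (simp add: F_def norm_mult norm_divide)
      finally have "norm (F T - F 0) / T \<le> (2 / \<bar>g\<bar>) / T"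
        using \<open>T > 0\<close> by (intro divide_right_mono) auto
      then show "norm ((1 / T) *\<^sub>R (F T - F 0)) \<le> (2 / \<bar>g\<bar>) / T"
        using \<open>T > 0\<close> by simp
    qed
    show "((\<lambda>T. (2 / \<bar>g\<bar>) / T) \<longlongrightarrow> 0) at_top"
      by (rule real_tendsto_divide_at_top[OF tendsto_const filterlim_ident])
  qed
  moreover have "\<forall>\<^sub>F T in at_top. time_average (\<lambda>t. cis (- (g * t))) T = (1 / T) *\<^sub>R (F T - F 0)"
    using eventually_gt_at_top[of 0] by eventually_elim (rule avg)
  ultimately show ?thesis using False by (simp add: tendsto_cong)
qed

text \<open>Averaging acts on the scalar phases alone. Actual convergence is established because
  \<open>Lim\<close> is only meaningful when the limit exists.\<close>

lemma infinite_time_average_exponential_sum: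
  fixes M :: "'i \<Rightarrow> complex^'n^'n"
  assumes "finite I"
  shows "infinite_time_average (\<lambda>t. \<Sum>a\<in>I. mat (cis (- (G a * t))) ** M a)
    = (\<Sum>a\<in>I. if G a = 0 then M a else 0)"
proof -
  have "time_average (\<lambda>t. mat (cis (- (G a * t))) ** M a) T
      = mat (time_average (\<lambda>t. cis (- (G a * t))) T) ** M a" for a T
  proof -
    have "(\<lambda>t. cis (- (G a * t))) integrable_on {0..T}"
      by (intro integrable_continuous_real continuous_intros)
    from integral_linear[OF this bounded_linear_mat_mult, of "M a"]
    have "integral {0..T} (\<lambda>t. mat (cis (- (G a * t))) ** M a)
        = mat (integral {0..T} (\<lambda>t. cis (- (G a * t)))) ** M a"
      by (simp add: o_def)
    then show ?thesis
      by (simp add: time_average_def linear_scale[OF bounded_linear.linear[OF bounded_linear_mat_mult]])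
  qed
  then have "time_average (\<lambda>t. \<Sum>a\<in>I. mat (cis (- (G a * t))) ** M a)
      = (\<lambda>T. \<Sum>a\<in>I. mat (time_average (\<lambda>t. cis (- (G a * t))) T) ** M a)"
    using assms
    by (intro ext, subst time_average_sum)
      (auto intro!: bounded_linear.continuous_on[OF bounded_linear_mat_mult] continuous_intros)
  moreover have "((\<lambda>T. \<Sum>a\<in>I. mat (time_average (\<lambda>t. cis (- (G a * t))) T) ** M a)
      \<longlongrightarrow> (\<Sum>a\<in>I. mat (if G a = 0 then 1 else 0) ** M a)) at_top"
    by (intro tendsto_sum bounded_linear.tendsto[OF bounded_linear_mat_mult]
        infinite_time_average_cis)
  moreover have "mat (if G a = 0 then 1 else 0) ** M a = (if G a = 0 then M a else 0)" for a
    by (simp add: vec_eq_iff mat_mult_component)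
  ultimately show ?thesis
    unfolding infinite_time_average_def by (simp add: tendsto_Lim)
qed

text \<open>The window position x ranges over all reals, but the counts are bounded by the number of
  pairs; hence the set under \<open>Max\<close> is finite.\<close>

lemma card_gaps_le_max_gap_count:
  "card {(i, j). i \<in> {1..dE} \<and> j \<in> {1..dE} \<and> i \<noteq> j \<and> E i - E j \<in> {x..<x + \<epsilon>}}
    \<le> max_gap_count dE E \<epsilon>"
proof -
  let ?c = "\<lambda>x::real. card {(i, j). i \<in> {1..dE} \<and> j \<in> {1..dE} \<and> i \<noteq> j \<and> E i - E j \<in> {x..<x + \<epsilon>}}"
  have "?c y \<le> card ({1..dE} \<times> {1..dE})" for y by (intro card_mono) auto
  then have "range ?c \<subseteq> {..card ({1..dE} \<times> {1..dE})}" by auto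
  then have "finite (range ?c)" by (rule finite_subset) simp
  then show ?thesis unfolding max_gap_count_def by (intro Max_ge) auto
qed

section \<open>Equilibration bound for a single observable\<close>

theorem theorem8p1:
  fixes H A \<rho>0 :: "complex^'n^'n"
    and P :: "nat \<Rightarrow> complex^'n^'n"
    and E :: "nat \<Rightarrow> real"
    and dE :: nat
    and \<epsilon> T :: real
  assumes "hamiltonian_spectrum H dE E P"
    and "density_operator \<rho>0"
    and "A \<noteq> 0"
    and "\<epsilon> > 0"
    and "T > 0"
  defines "\<rho> \<equiv> evolve H \<rho>0"
  defines "\<omega> \<equiv> infinite_time_average \<rho>"
  shows "time_average (\<lambda>t. (cmod (trace (\<rho> t ** A) - trace (\<omega> ** A)))\<^sup>2) T / (op_norm A)\<^sup>2
    \<le> real (max_gap_count dE E \<epsilon>) / effective_dimension dE P \<rho>0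
        * (5 * pi / 2) * (3 / 4 + 1 / (\<epsilon> * T))"
proof -
  define K where "K = {1..dE} \<times> {1..dE}"
  define I where "I = {(i, j). i \<in> {1..dE} \<and> j \<in> {1..dE} \<and> i \<noteq> j}"
  define G where "G = (\<lambda>(i, j). E i - E j)"
  define M where "M = (\<lambda>(i, j). P i ** \<rho>0 ** P j)"
  define v where "v a = trace (M a ** A)" for a
  let ?N = "max_gap_count dE E \<epsilon>"
  let ?C = "(5 * pi / 2) * (3 / 4 + 1 / (\<epsilon> * T))"
  let ?p = "\<lambda>n. Re (trace (P n ** \<rho>0))"
  have psd: "psd \<rho>0" using assms(2) by (simp add: density_operator_def psd_def)
  interpret projector_family P "{1..dE}"
    by (rule hamiltonian_spectrum_projectors(2)[OF assms(1)])
  have fin: "finite K" "finite I" "I \<subseteq> K"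
    by (auto simp: K_def I_def intro: finite_subset[of _ "{1..dE} \<times> {1..dE}"])
  have inj: "inj_on E {1..dE}"
    using assms(1) by (auto simp: hamiltonian_spectrum_def bij_betw_def)
  \<comment> \<open>Distinct energies make the gap vanish on diagonal pairs only, so subtracting
    \<open>\<omega>\<close> removes exactly the diagonal from the sum over K.\<close>
  have G0: "G a = 0 \<longleftrightarrow> a \<notin> I" if "a \<in> K" for a
    using that inj by (auto simp: G_def K_def I_def inj_on_def)
  have \<rho>: "\<rho> = (\<lambda>t. \<Sum>a\<in>K. mat (cis (- (G a * t))) ** M a)"
    unfolding \<rho>_def evolve_spectral[OF assms(1)] K_def G_def M_def
    by (simp add: sum.cartesian_product case_prod_unfold)
  have "\<omega> = (\<Sum>a\<in>K. if G a = 0 then M a else 0)"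
    unfolding \<omega>_def \<rho> by (rule infinite_time_average_exponential_sum[OF fin(1)])
  then have "trace (\<omega> ** A) = (\<Sum>a\<in>K. if G a = 0 then v a else 0)"
    by (simp add: mult_sum_left trace_sum v_def if_distrib[where f="\<lambda>X. trace (X ** A)"]
        trace_def[of 0] cong: if_cong)
  moreover have "trace (\<rho> t ** A) = (\<Sum>a\<in>K. v a * cis (- (G a * t)))" for t
    unfolding \<rho> by (simp add: mult_sum_left trace_sum v_def matrix_mul_assoc[symmetric]
        trace_mat_mult mult.commute)
  ultimately have "trace (\<rho> t ** A) - trace (\<omega> ** A)
      = (\<Sum>a\<in>K. v a * cis (- (G a * t)) - (if G a = 0 then v a else 0))" for t
    by (simp add: sum_subtractf)
  moreover have "v a * cis (- (G a * t)) - (if G a = 0 then v a else 0)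
      = (if a \<in> I then v a * cis (- (G a * t)) else 0)" if "a \<in> K" for a t
    using G0[OF that] by (cases "a \<in> I") auto
  ultimately have diff: "trace (\<rho> t ** A) - trace (\<omega> ** A) = (\<Sum>a\<in>I. v a * cis (- (G a * t)))" for t
    using fin by (simp add: sum.If_cases inf.absorb2 cong: sum.cong)
  have "card {a \<in> I. G a \<in> {x..<x + \<epsilon>}} \<le> ?N" for x
  proof -
    have "{a \<in> I. G a \<in> {x..<x + \<epsilon>}}
        = {(i, j). i \<in> {1..dE} \<and> j \<in> {1..dE} \<and> i \<noteq> j \<and> E i - E j \<in> {x..<x + \<epsilon>}}"
      by (auto simp: I_def G_def)
    then show ?thesis using card_gaps_le_max_gap_count[of dE E x \<epsilon>] by simp
  qed
  then have "time_average (\<lambda>t. (cmod (trace (\<rho> t ** A) - trace (\<omega> ** A)))\<^sup>2) T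
      \<le> real ?N * (\<Sum>a\<in>I. (cmod (v a))\<^sup>2) * (5 * pi / 2) * (3 / 4 + 1 / (\<epsilon> * T))"
    unfolding diff by (rule time_average_exponential_sum_le[OF fin(2) assms(4,5)])
  also have "\<dots> = (real ?N * ?C) * (\<Sum>a\<in>I. (cmod (v a))\<^sup>2)" by simp
  also have "\<dots> \<le> (real ?N * ?C) * ((op_norm A)\<^sup>2 * (\<Sum>n=1..dE. (?p n)\<^sup>2))"
  proof (intro mult_left_mono)
    \<comment> \<open>The nonnegative diagonal terms are restored to reach the full double sum
      bounded by Bessel's inequality.\<close>
    have "(\<Sum>a\<in>I. (cmod (v a))\<^sup>2) \<le> (\<Sum>a\<in>K. (cmod (v a))\<^sup>2)"
      using fin by (intro sum_mono2) auto
    also have "\<dots> = (\<Sum>i=1..dE. \<Sum>j=1..dE. (cmod (trace (P i ** \<rho>0 ** P j ** A)))\<^sup>2)"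
      by (simp add: K_def v_def M_def sum.cartesian_product case_prod_unfold)
    also have "\<dots> \<le> (op_norm A)\<^sup>2 * (\<Sum>n=1..dE. (?p n)\<^sup>2)"
      by (rule sum_coherence_sq_le[OF psd])
    finally show "(\<Sum>a\<in>I. (cmod (v a))\<^sup>2) \<le> (op_norm A)\<^sup>2 * (\<Sum>n=1..dE. (?p n)\<^sup>2)" .
  qed (use assms(4,5) in simp)
  finally have main: "time_average (\<lambda>t. (cmod (trace (\<rho> t ** A) - trace (\<omega> ** A)))\<^sup>2) T
      \<le> (real ?N * ?C * (\<Sum>n=1..dE. (?p n)\<^sup>2)) * (op_norm A)\<^sup>2" by (simp only: mult_ac)
  have "0 \<le> real ?N * ?C * (\<Sum>n=1..dE. (?p n)\<^sup>2)"
    using assms(4,5) by (simp add: sum_nonneg)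
  \<comment> \<open>Where the operator norm is 0, the quotient is 0 by convention and the right-hand
    side is nonnegative.\<close>
  with main have "time_average (\<lambda>t. (cmod (trace (\<rho> t ** A) - trace (\<omega> ** A)))\<^sup>2) T / (op_norm A)\<^sup>2
      \<le> real ?N * ?C * (\<Sum>n=1..dE. (?p n)\<^sup>2)"
    by (cases "op_norm A = 0") (simp_all add: divide_le_eq)
  \<comment> \<open>Dividing by the effective dimension is multiplying by the sum of squared
    populations.\<close>
  then show ?thesis by (simp only: effective_dimension_def divide_divide_eq_right div_by_1 mult_1_right mult_ac)
qed

end
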